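(* Let $\mathbb{X}$ be a reflexive real Banach space with dual $\mathbb{X}^{\ast}$. If $A:\mathbb{X}\rightrightarrows\mathbb{X}^{\ast}$ is a maximal monotone operator, then $R\left(J_{\mathbb{X}}+\lambda A\right)=\mathbb{X}^{\ast}$ for all $\lambda>0$.
   Context: $\langle x,x^{\ast}\rangle=\langle x^{\ast},x\rangle$ denotes the value $x^{\ast}(x)$ of $x^{\ast}\in\mathbb{X}^{\ast}$ at $x\in\mathbb{X}$. A point-to-set operator $A:\mathbb{X}\rightrightarrows\mathbb{X}^{\ast}$ assigns to each $x\in\mathbb{X}$ a subset $A(x)\subset\mathbb{X}^{\ast}$ and is identified with its graph $\{(x,x^{\ast}):x^{\ast}\in A(x)\}$. It is monotone if $\langle x-y,x^{\ast}-y^{\ast}\rangle\geq0$ for all $(x,x^{\ast}),(y,y^{\ast})\in A$, and a monotone operator is maximal monotone if its graph is not properly contained in the graph of any other monotone operator. The duality mapping $J_{\mathbb{X}}:\mathbb{X}\rightrightarrows\mathbb{X}^{\ast}$ is $J_{\mathbb{X}}(x)=\{x^{\ast}\in\mathbb{X}^{\ast}:\langle x,x^{\ast}\rangle=\|x\|^{2}=\|x^{\ast}\|_{\mathbb{X}^{\ast}}^{2}\}$. For point-to-set operators $A,B:\mathbb{X}\rightrightarrows\mathbb{X}^{\ast}$ and $\lambda>0$, $(B+\lambda A)(x)=\{b^{\ast}+\lambda a^{\ast}:b^{\ast}\in B(x),\,a^{\ast}\in A(x)\}$ (empty if $A(x)$ or $B(x)$ is empty), and the range is $R(A)=\{x^{\ast}\in\mathbb{X}^{\ast}:\exists\,x\in\mathbb{X},\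 x^{\ast}\in A(x)\}$. *)

theory Defs
  imports "HOL-Analysis.Analysis"
begin

text \<open>The topological dual of a real normed space \<open>'a\<close> is the type \<open>'a \<Rightarrow>\<^sub>L real\<close> with the
  operator norm, and the pairing of \<open>x\<close> with \<open>f\<close> is \<open>blinfun_apply f x\<close>.\<close>

lift_definition canonical_embedding ::
  "'a::real_normed_vector \<Rightarrow> (('a \<Rightarrow>\<^sub>L real) \<Rightarrow>\<^sub>L real)"
  is "\<lambda>x f. blinfun_apply f x"
  by (rule blinfun.bounded_linear_left)

definition reflexive_space :: "'a::real_normed_vector itself \<Rightarrow> bool" where
  "reflexive_space _ \<longleftrightarrow>
     surj (canonical_embedding :: 'a \<Rightarrow> (('a \<Rightarrow>\<^sub>L real) \<Rightarrow>\<^sub>L real))"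

definition op_graph :: "('a \<Rightarrow> 'b set) \<Rightarrow> ('a \<times> 'b) set" where
  "op_graph A = {(x, y). y \<in> A x}"

definition op_range :: "('a \<Rightarrow> 'b set) \<Rightarrow> 'b set" where
  "op_range A = {y. \<exists>x. y \<in> A x}"

definition monotone_op :: "('a::real_normed_vector \<Rightarrow> ('a \<Rightarrow>\<^sub>L real) set) \<Rightarrow> bool" where
  "monotone_op A \<longleftrightarrow>
     (\<forall>(x, f) \<in> op_graph A. \<forall>(y, g) \<in> op_graph A. blinfun_apply (f - g) (x - y) \<ge> 0)"

definition maximal_monotone_op :: "('a::real_normed_vector \<Rightarrow> ('a \<Rightarrow>\<^sub>L real) set) \<Rightarrow> bool" where
  "maximal_monotone_op A \<longleftrightarrow>
     monotone_op A \<and> \<not> (\<exists>B. monotone_op B \<and> op_graph A \<subset> op_graph B)"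

definition duality_mapping :: "'a::real_normed_vector \<Rightarrow> ('a \<Rightarrow>\<^sub>L real) set" where
  "duality_mapping x = {f. blinfun_apply f x = (norm x)\<^sup>2 \<and> (norm x)\<^sup>2 = (norm f)\<^sup>2}"

definition op_add :: "('a \<Rightarrow> 'b::real_vector set) \<Rightarrow> ('a \<Rightarrow> 'b set) \<Rightarrow> 'a \<Rightarrow> 'b set" where
  "op_add B A x = {b + a | b a. b \<in> B x \<and> a \<in> A x}"

definition op_scale :: "real \<Rightarrow> ('a \<Rightarrow> 'b::real_vector set) \<Rightarrow> 'a \<Rightarrow> 'b set" where
  "op_scale c A x = {c *\<^sub>R a | a. a \<in> A x}"

end

theory Submission
  imports Defs
begin

text \<open>
  Let \<open>G\<close> be the graph of \<open>x \<mapsto> c A x - p\<close>, which is again maximal monotone. Solving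
  \<open>p \<in> J x + c A x\<close> amounts to finding \<open>(y, h) \<in> G\<close> with \<open>- h \<in> J y\<close>, which is the equality case of
  the inequality \<open>\<langle>x, f\<rangle> + \<parallel>x\<parallel>\<^sup>2/2 + \<parallel>f\<parallel>\<^sup>2/2 \<ge> 0\<close>. The proof, due to Simons and Zalinescu, finds such a
  pair by separating two convex functions on \<open>X \<times> X\<^sup>*\<close>.

  The Fitzpatrick function of \<open>G\<close> is the supremum over \<open>(y, g) \<in> G\<close> of the affine functions
  \<open>(x, f) \<mapsto> \<langle>x, g\<rangle> + \<langle>y, f\<rangle> - \<langle>y, g\<rangle>\<close>. It is convex. It lies above the pairing \<open>\<langle>x, f\<rangle>\<close>
  because \<open>G\<close> is maximal, and on \<open>G\<close> it does not exceed the pairing because \<open>G\<close> is monotone. Hence it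
  lies above \<open>z \<mapsto> - \<parallel>z\<parallel>\<^sup>2/2\<close>, where the norm on the product is the Euclidean combination of the two
  norms. The sandwich form of the Hahn--Banach theorem (\<open>affine_sandwich\<close>) yields an affine function
  \<open>l + \<alpha>\<close> in between. Its linear part is bounded since it dominates a negative quadratic
  (\<open>linear_le_half_norm_square\<close>), so it is given by an element of \<open>X\<^sup>* \<times> X\<^sup>*\<^sup>*\<close>, and by reflexivity
  \<open>l (x, f) = \<langle>x, h\<rangle> + \<langle>y, f\<rangle>\<close> for some \<open>h\<close> and \<open>y\<close>. The quadratic lower bound then gives
  \<open>\<alpha> \<ge> \<parallel>h\<parallel>\<^sup>2/2 + \<parallel>y\<parallel>\<^sup>2/2\<close> (\<open>half_norm_square_le\<close> and \<open>norm_canonical_embedding\<close>), while on \<open>G\<close> the upper bound gives, for all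
  \<open>(b, g) \<in> G\<close>,
  \<open>\<langle>y - b, h - g\<rangle> \<ge> \<parallel>h\<parallel>\<^sup>2/2 + \<parallel>y\<parallel>\<^sup>2/2 + \<langle>y, h\<rangle> \<ge> (\<parallel>h\<parallel> - \<parallel>y\<parallel>)\<^sup>2/2 \<ge> 0\<close>.
  By maximality \<open>(y, h) \<in> G\<close>, and inserting \<open>(b, g) = (y, h)\<close> turns the chain into equalities, which say
  exactly that \<open>- h \<in> J y\<close>.
\<close>

section \<open>Hahn--Banach by enlarging convex cones\<close>

lemma convex_cone_Union_chain:
  assumes "\<C> \<noteq> {}" and "subset.chain {S. convex_cone S} \<C>"
  shows "convex_cone (\<Union>\<C>)"
proof -
  have cone: "convex_cone S" if "S \<in> \<C>" for S
    using assms that by (auto simp: subset_chain_def)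
  have "x + y \<in> \<Union>\<C>" if xy: "x \<in> \<Union>\<C>" "y \<in> \<Union>\<C>" for x y
  proof -
    obtain S T where ST: "S \<in> \<C>" "x \<in> S" "T \<in> \<C>" "y \<in> T"
      using xy by blast
    then have "S \<subseteq> T \<or> T \<subseteq> S"
      using assms(2) by (auto simp: subset_chain_def)
    then show ?thesis
      using ST convex_cone_add[OF cone] by (meson UnionI subsetD)
  qed
  moreover have "0 \<in> \<Union>\<C>"
    using assms(1) cone convex_cone_contains_0 by blast
  moreover have "c *\<^sub>R x \<in> \<Union>\<C>" if "x \<in> \<Union>\<C>" "c \<ge> 0" for c x
    using that cone convex_cone_scaleR by blast
  ultimately show ?thesis
    unfolding convex_cone_iff by blast
qed

text \<open>
  The Hahn--Banach theorem, with a convex cone in the role of the epigraph of a sublinear functional.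
  Zorn's lemma gives a maximal cone \<open>M \<supseteq> C\<close> that contains no \<open>(0, r)\<close> with \<open>r < 0\<close>. Such an \<open>M\<close> must
  be the epigraph of a linear functional: the lower boundary \<open>q\<close> of \<open>M\<close> is finite, and adding the ray
  through \<open>(- v, - q v)\<close> to \<open>M\<close> creates no negative multiple of \<open>(0, 1)\<close>, so this ray lies in \<open>M\<close>
  already. Thus the graph of \<open>q\<close> is symmetric and closed under the operations of the cone.
\<close>

lemma convex_cone_minorant:
  fixes C :: "('v::real_vector \<times> real) set"
  assumes C: "convex_cone C"
    and full: "fst ` C = UNIV"
    and nonneg: "\<And>r. (0, r) \<in> C \<Longrightarrow> 0 \<le> r"
  obtains L :: "'v \<Rightarrow> real" where "linear L" "\<And>v r. (v, r) \<in> C \<Longrightarrow> L v \<le> r"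
proof -
  define \<A> where "\<A> = {S. convex_cone S \<and> C \<subseteq> S \<and> (\<forall>r. (0, r) \<in> S \<longrightarrow> 0 \<le> r)}"
  have "\<exists>M\<in>\<A>. \<forall>X\<in>\<A>. M \<subseteq> X \<longrightarrow> X = M"
  proof (rule subset_Zorn_nonempty)
    show "\<A> \<noteq> {}"
      using C nonneg by (auto simp: \<A>_def)
    fix \<C> assume "\<C> \<noteq> {}" and ch: "subset.chain \<A> \<C>"
    moreover have "subset.chain {S. convex_cone S} \<C>"
      using ch by (auto simp: subset_chain_def \<A>_def)
    ultimately show "\<Union>\<C> \<in> \<A>"
      using convex_cone_Union_chain[of \<C>] by (fastforce simp: subset_chain_def \<A>_def)
  qed
  then obtain M where M: "M \<in> \<A>" and max: "\<And>X. X \<in> \<A> \<Longrightarrow> M \<subseteq> X \<Longrightarrow> X = M"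
    by blast
  have cone: "convex_cone M" and CM: "C \<subseteq> M" and pos: "\<And>r. (0, r) \<in> M \<Longrightarrow> 0 \<le> r"
    using M by (auto simp: \<A>_def)
  define q where "q v = Inf {r. (v, r) \<in> M}" for v
  have ex: "\<exists>r. (v, r) \<in> M" for v
  proof -
    have "v \<in> fst ` C" by (simp add: full)
    then show ?thesis using CM by auto
  qed
  have bdd: "bdd_below {r. (v, r) \<in> M}" for v
  proof -
    obtain s where s: "(- v, s) \<in> M"
      using ex by blast
    have "- s \<le> r" if "(v, r) \<in> M" for r
      using convex_cone_add[OF cone that s] pos[of "r + s"] by simp
    then show ?thesis
      by (intro bdd_belowI[of _ "- s"]) simp
  qed
  have q_le: "q v \<le> r" if "(v, r) \<in> M" for v r
    unfolding q_def using bdd that by (auto intro: cInf_lower)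
  have q_greatest: "a \<le> q v" if "\<And>r. (v, r) \<in> M \<Longrightarrow> a \<le> r" for a v
    unfolding q_def using ex that by (intro cInf_greatest) auto
  have neg_in: "(- v, - q v) \<in> M" for v
  proof -
    define R where "R = conic hull {(- v, - q v)}"
    define X where "X = (\<Union>x\<in>M. \<Union>y\<in>R. {x + y})"
    have R: "convex_cone R"
      unfolding R_def convex_cone_def
      by (simp add: conic_hull_eq_empty conic_conic_hull convex_conic_hull)
    have R_eq: "R = {t *\<^sub>R (- v, - q v) | t. 0 \<le> t}"
      unfolding R_def conic_hull_explicit by auto
    have MX: "M \<subseteq> X"
      unfolding X_def using convex_cone_contains_0[OF R] by force
    have "X \<in> \<A>"
    proof -
      have "convex_cone X"
        unfolding X_def using cone R by (rule convex_cone_sums)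
      moreover have "0 \<le> r" if r: "(0, r) \<in> X" for r
      proof -
        obtain s t where ws: "(t *\<^sub>R v, s) \<in> M" and t: "0 \<le> t"
          and eq: "r = s - t * q v"
          using r unfolding X_def R_eq by auto
        show ?thesis
        proof (cases "t = 0")
          case True
          then show ?thesis using pos ws eq by simp
        next
          case False
          then have "(v, s / t) \<in> M"
            using convex_cone_scaleR[OF cone _ ws, of "1 / t"] t eq by simp
          then show ?thesis
            using q_le[of v "s / t"] False t eq by (simp add: field_simps)
        qed
      qed
      ultimately show ?thesis
        using CM MX by (auto simp: \<A>_def)
    qed
    then have "X = M"
      using MX by (rule max)
    moreover have "(- v, - q v) \<in> R"
      unfolding R_eq by (rule CollectI, rule exI[of _ 1]) simp
    then have "(- v, - q v) \<in> X"
      unfolding X_def using convex_cone_contains_0[OF cone] by force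
    ultimately show ?thesis
      by simp
  qed
  \<comment> \<open>The infimum is attained, because \<open>q\<close> turns out to be odd.\<close>
  have q_in: "(v, q v) \<in> M" for v
  proof -
    have "q (- v) \<le> - q v"
      using neg_in q_le by blast
    moreover have "- q v \<le> q (- v)"
    proof (rule q_greatest)
      fix s assume s: "(- v, s) \<in> M"
      have "- s \<le> q v"
      proof (rule q_greatest)
        fix r assume "(v, r) \<in> M"
        from convex_cone_add[OF cone this s] show "- s \<le> r"
          using pos[of "r + s"] by simp
      qed
      then show "- q v \<le> s" by simp
    qed
    ultimately show ?thesis
      using neg_in[of "- v"] by simp
  qed
  have q_eq: "q v = r" if "(v, r) \<in> M" "(- v, - r) \<in> M" for v r
  proof (rule antisym)
    show "q v \<le> r" using that q_le by blast
    show "r \<le> q v"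
      using convex_cone_add[OF cone q_in[of v] that(2)] pos[of "q v - r"] by simp
  qed
  have "linear q"
  proof (rule linearI)
    fix u v
    show "q (u + v) = q u + q v"
      using convex_cone_add[OF cone q_in[of u] q_in[of v]]
        convex_cone_add[OF cone neg_in[of u] neg_in[of v]]
      by (intro q_eq) (simp_all add: algebra_simps)
  next
    fix c :: real and v
    show "q (c *\<^sub>R v) = c *\<^sub>R q v"
    proof (cases "c \<ge> 0")
      case True
      then show ?thesis
        using convex_cone_scaleR[OF cone True q_in[of v]]
          convex_cone_scaleR[OF cone True neg_in[of v]]
        by (intro q_eq) simp_all
    next
      case False
      then have "0 \<le> - c" by simp
      then show ?thesis
        using convex_cone_scaleR[OF cone \<open>0 \<le> - c\<close> q_in[of v]]
          convex_cone_scaleR[OF cone \<open>0 \<le> - c\<close> neg_in[of v]]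
        by (intro q_eq) simp_all
    qed
  qed
  then show ?thesis
    using that[of q] q_le CM by blast
qed

text \<open>
  An affine function on \<open>V\<close> is a linear functional on \<open>V \<times> \<real>\<close> evaluated at height \<open>1\<close>. The upper bounds,
  placed at height \<open>1\<close>, and the lower bounds, reflected to height \<open>- 1\<close>, all become upper bounds for that
  functional, and the cone generated by them is the input of \<open>convex_cone_minorant\<close>. An element of the
  cone above \<open>0\<close> weighs both kinds of bounds equally and at the same point, where \<open>sep\<close> makes it
  nonnegative. The set \<open>D\<close> stands for the epigraph of a convex function that may take the value
  \<open>\<infinity>\<close>, whereas \<open>g\<close> is finite everywhere, so that the cone projects onto all of \<open>V \<times> \<real>\<close>.
\<close>

lemma affine_sandwich:
  fixes D :: "('v::real_vector \<times> real) set" and g :: "'v \<Rightarrow> real"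
  assumes D: "convex D" "D \<noteq> {}"
    and g: "convex_on UNIV g"
    and sep: "\<And>x r. (x, r) \<in> D \<Longrightarrow> - g x \<le> r"
  obtains l :: "'v \<Rightarrow> real" and \<alpha> :: real
  where "linear l" "\<And>x r. (x, r) \<in> D \<Longrightarrow> l x + \<alpha> \<le> r" "\<And>x. - g x \<le> l x + \<alpha>"
proof -
  define P where "P = conic hull {((x, 1::real), r) | x r. (x, r) \<in> D}"
  define Q where "Q = conic hull {((- x, - 1::real), s) | x s. g x \<le> s}"
  define C where "C = (\<Union>p\<in>P. \<Union>q\<in>Q. {p + q})"
  have P_eq: "P = {((t *\<^sub>R x, t), t * r) | t x r. 0 \<le> t \<and> (x, r) \<in> D}"
    unfolding P_def conic_hull_explicit by force
  have Q_eq: "Q = {((- (t *\<^sub>R x), - t), t * s) | t x s. 0 \<le> t \<and> g x \<le> s}"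
    unfolding Q_def conic_hull_explicit by force
  have P: "convex_cone P"
  proof -
    have "convex {((x, 1::real), r) | x r. (x, r) \<in> D}"
    proof (rule convexI)
      fix p q :: "('v \<times> real) \<times> real" and u v :: real
      assume "p \<in> {((x, 1), r) | x r. (x, r) \<in> D}" "q \<in> {((x, 1), r) | x r. (x, r) \<in> D}"
        and uv: "0 \<le> u" "0 \<le> v" "u + v = 1"
      then obtain x y r s where p: "p = ((x, 1), r)" "(x, r) \<in> D" and q: "q = ((y, 1), s)" "(y, s) \<in> D"
        by blast
      have "(u *\<^sub>R x + v *\<^sub>R y, u * r + v * s) \<in> D"
        using convexD[OF D(1) p(2) q(2) uv] by simp
      moreover have "u *\<^sub>R p + v *\<^sub>R q = ((u *\<^sub>R x + v *\<^sub>R y, 1), u * r + v * s)"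
        using uv by (simp add: p q)
      ultimately show "u *\<^sub>R p + v *\<^sub>R q \<in> {((x, 1), r) | x r. (x, r) \<in> D}"
        by blast
    qed
    then show ?thesis
      unfolding P_def convex_cone_def using D(2)
      by (auto simp: conic_hull_eq_empty conic_conic_hull convex_conic_hull)
  qed
  have Q: "convex_cone Q"
  proof -
    have "convex {((- x, - 1::real), s) | x s. g x \<le> s}"
    proof (rule convexI)
      fix p q :: "('v \<times> real) \<times> real" and u v :: real
      assume "p \<in> {((- x, - 1), s) | x s. g x \<le> s}" "q \<in> {((- x, - 1), s) | x s. g x \<le> s}"
        and uv: "0 \<le> u" "0 \<le> v" "u + v = 1"
      then obtain x y r s where p: "p = ((- x, - 1), r)" "g x \<le> r" and q: "q = ((- y, - 1), s)" "g y \<le> s"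
        by blast
      have "g (u *\<^sub>R x + v *\<^sub>R y) \<le> u * g x + v * g y"
        using g uv by (auto simp: convex_on_def)
      also have "\<dots> \<le> u * r + v * s"
        using p q uv by (intro add_mono mult_left_mono) auto
      finally have "g (u *\<^sub>R x + v *\<^sub>R y) \<le> u * r + v * s" .
      moreover have "u *\<^sub>R p + v *\<^sub>R q = ((- (u *\<^sub>R x + v *\<^sub>R y), - 1), u * r + v * s)"
        using uv by (simp add: p q)
      ultimately show "u *\<^sub>R p + v *\<^sub>R q \<in> {((- x, - 1), s) | x s. g x \<le> s}"
        by blast
    qed
    then show ?thesis
      unfolding Q_def convex_cone_def
      by (auto simp: conic_hull_eq_empty conic_conic_hull convex_conic_hull)
  qed
  have cone: "convex_cone C"
    unfolding C_def using P Q by (rule convex_cone_sums)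
  have C_I: "((t *\<^sub>R x - u *\<^sub>R y, t - u), t * r + u * s) \<in> C"
    if "0 \<le> t" "0 \<le> u" "(x, r) \<in> D" "g y \<le> s" for t u x y r s
  proof -
    have "((t *\<^sub>R x, t), t * r) \<in> P" "((- (u *\<^sub>R y), - u), u * s) \<in> Q"
      using that unfolding P_eq Q_eq by blast+
    then have "((t *\<^sub>R x, t), t * r) + ((- (u *\<^sub>R y), - u), u * s) \<in> C"
      unfolding C_def by blast
    then show ?thesis
      by simp
  qed
  obtain x0 r0 where D0: "(x0, r0) \<in> D"
    using D(2) by (metis all_not_in_conv surj_pair)
  have "v \<in> fst ` C" for v
  proof -
    obtain z a where v: "v = (z, a)" by (cases v)
    \<comment> \<open>A large weight \<open>t\<close> on \<open>x0\<close> leaves a positive weight \<open>t - a\<close> for \<open>y\<close>, which is free to be chosen.\<close>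
    define t where "t = max 0 (a + 1)"
    have t: "0 \<le> t" "0 < t - a" by (auto simp: t_def)
    define y where "y = (1 / (t - a)) *\<^sub>R (t *\<^sub>R x0 - z)"
    have "((t *\<^sub>R x0 - (t - a) *\<^sub>R y, t - (t - a)), t * r0 + (t - a) * g y) \<in> C"
      using t D0 by (intro C_I) auto
    moreover have "t *\<^sub>R x0 - (t - a) *\<^sub>R y = z"
      using t by (simp add: y_def)
    ultimately show ?thesis
      unfolding v by force
  qed
  then have full: "fst ` C = UNIV" by auto
  have nonneg: "0 \<le> r" if r: "(0, r) \<in> C" for r
  proof -
    obtain t x d u y s where tu: "0 \<le> t" "0 \<le> u" "(x, d) \<in> D" "g y \<le> s"
      and eq: "t *\<^sub>R x = u *\<^sub>R y" "t = u" "r = t * d + u * s"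
      using r unfolding C_def P_eq Q_eq by (auto simp: zero_prod_def)
    show ?thesis
    proof (cases "t = 0")
      case False
      then have "x = y" using eq by simp
      then have "0 \<le> d + s" using sep[of x d] tu by simp
      then show ?thesis using tu eq by (simp flip: distrib_left)
    qed (use eq in simp)
  qed
  obtain L :: "'v \<times> real \<Rightarrow> real" where L: "linear L" and LC: "\<And>v r. (v, r) \<in> C \<Longrightarrow> L v \<le> r"
    using convex_cone_minorant[OF cone full nonneg] by blast
  have L_eq: "L (x, a) = L (x, 0) + a * L (0, 1)" for x a
    using linear_add[OF L, of "(x, 0)" "a *\<^sub>R (0, 1)"] linear_scale[OF L, of a "(0, 1)"] by simp
  show thesis
  proof (rule that[of "\<lambda>x. L (x, 0)" "L (0, 1)"])
    show "linear (\<lambda>x. L (x, 0))"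
      using linear_add[OF L] linear_scale[OF L]
      by (intro linearI) (metis add_Pair add.right_neutral, metis scaleR_Pair scaleR_zero_right)
    show "L (x, 0) + L (0, 1) \<le> r" if "(x, r) \<in> D" for x r
      using LC[OF C_I[of 1 0 x r 0 "g 0"]] that L_eq[of x 1] by simp
    show "- g x \<le> L (x, 0) + L (0, 1)" for x
      using LC[OF C_I[of 0 1 x0 r0 x "g x"]] D0 L_eq[of "- x" "- 1"]
        linear_neg[OF L, of "(x, 0)"] by simp
  qed
qed

text \<open>
  The sandwich theorem is applied to the one-point set \<open>{(x, - norm x)}\<close> above the function \<open>- norm\<close>.
  The constant term of the resulting affine function is absorbed by homogeneity, and the negative of
  its linear part is the norming functional.
\<close>

lemma blinfun_norming:
  fixes x :: "'a::real_normed_vector"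
  obtains f :: "'a \<Rightarrow>\<^sub>L real" where "norm f \<le> 1" "blinfun_apply f x = norm x"
proof -
  obtain l :: "'a \<Rightarrow> real" and \<alpha> where l: "linear l" and x: "l x + \<alpha> \<le> - norm x"
    and bound: "\<And>y. - norm y \<le> l y + \<alpha>"
  proof (rule affine_sandwich[of "{(x, - norm x)}" norm])
    show "convex_on UNIV (norm :: 'a \<Rightarrow> real)"
      using convex_on_dist[of UNIV "0::'a"] by simp
  qed auto
  have "0 \<le> \<alpha>"
    using bound[of 0] linear_0[OF l] by simp
  have le: "- l y \<le> norm y" for y
  proof (rule field_le_epsilon)
    fix e :: real assume "0 < e"
    \<comment> \<open>Scaling \<open>y\<close> by \<open>t\<close> divides the constant term by \<open>t\<close>; adding \<open>1\<close> keeps \<open>t\<close> positive when \<open>\<alpha> = 0\<close>.\<close>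
    define t where "t = (\<alpha> + 1) / e"
    have t: "0 < t" "\<alpha> / t \<le> e"
      using \<open>0 < e\<close> \<open>0 \<le> \<alpha>\<close> by (simp_all add: t_def field_simps)
    have "- (t * norm y) \<le> t * l y + \<alpha>"
      using bound[of "t *\<^sub>R y"] linear_scale[OF l] t by simp
    then have "- norm y \<le> l y + \<alpha> / t"
      using t by (simp add: field_simps)
    then show "- l y \<le> norm y + e" using t by simp
  qed
  have abs: "\<bar>l y\<bar> \<le> norm y" for y
    using le[of y] le[of "- y"] linear_neg[OF l, of y] by simp
  have "bounded_linear (\<lambda>y. - l y)"
    by (rule bounded_linear_intro[of _ 1])
      (use abs linear_add[OF l] linear_scale[OF l] in auto)
  then have f: "blinfun_apply (Blinfun (\<lambda>y. - l y)) = (\<lambda>y. - l y)"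
    by (rule bounded_linear_Blinfun_apply)
  show thesis
  proof (rule that[of "Blinfun (\<lambda>y. - l y)"])
    show "norm (Blinfun (\<lambda>y. - l y)) \<le> 1"
      by (rule norm_blinfun_bound) (use abs in \<open>auto simp: f\<close>)
    show "blinfun_apply (Blinfun (\<lambda>y. - l y)) x = norm x"
      using le[of x] x \<open>0 \<le> \<alpha>\<close> by (simp add: f)
  qed
qed

lemma norm_canonical_embedding: "norm (canonical_embedding x) = norm x"
proof (rule antisym)
  show "norm (canonical_embedding x) \<le> norm x"
  proof (rule norm_blinfun_bound)
    show "norm (blinfun_apply (canonical_embedding x) f) \<le> norm x * norm f" for f
      using norm_blinfun[of f x] by (simp add: canonical_embedding.rep_eq mult.commute)
  qed simp
  obtain f :: "'a \<Rightarrow>\<^sub>L real" where f: "norm f \<le> 1" "blinfun_apply f x = norm x"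
    by (rule blinfun_norming)
  have "norm x \<le> norm (canonical_embedding x) * norm f"
    using norm_blinfun[of "canonical_embedding x" f] f by (simp add: canonical_embedding.rep_eq)
  also have "\<dots> \<le> norm (canonical_embedding x)"
    using f by (simp add: mult_left_le)
  finally show "norm x \<le> norm (canonical_embedding x)" .
qed

section \<open>Half the squared norm\<close>

lemma convex_on_half_norm_square: "convex_on UNIV (\<lambda>x::'a::real_normed_vector. (norm x)\<^sup>2 / 2)"
proof (rule convex_onI)
  fix t :: real and x y :: 'a assume t: "0 < t" "t < 1"
  have "norm ((1 - t) *\<^sub>R x + t *\<^sub>R y) \<le> (1 - t) * norm x + t * norm y"
    using norm_triangle_ineq[of "(1 - t) *\<^sub>R x" "t *\<^sub>R y"] t by simp
  then have "(norm ((1 - t) *\<^sub>R x + t *\<^sub>R y))\<^sup>2 \<le> ((1 - t) * norm x + t * norm y)\<^sup>2"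
    by (intro power_mono) auto
  also have "\<dots> \<le> (1 - t) * (norm x)\<^sup>2 + t * (norm y)\<^sup>2"
    using convex_onD[OF convex_power2, of t "norm x" "norm y"] t by simp
  finally show "(norm ((1 - t) *\<^sub>R x + t *\<^sub>R y))\<^sup>2 / 2 \<le> (1 - t) * ((norm x)\<^sup>2 / 2) + t * ((norm y)\<^sup>2 / 2)"
    by simp
qed simp

text \<open>
  Along the line spanned by \<open>x\<close> the hypothesis bounds a quadratic polynomial in \<open>t\<close> from below, and the
  discriminant of that polynomial gives the estimate. The same lemma serves to prove that a functional
  is bounded and to estimate its norm.
\<close>

lemma linear_le_half_norm_square:
  fixes l :: "'a::real_normed_vector \<Rightarrow> real"
  assumes l: "linear l" and le: "\<And>x. l x \<le> \<beta> + (norm x)\<^sup>2 / 2"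
  shows "0 \<le> \<beta>" and "\<bar>l x\<bar> \<le> sqrt (2 * \<beta>) * norm x"
proof -
  show \<beta>: "0 \<le> \<beta>"
    using le[of 0] linear_0[OF l] by simp
  have key: "t * l x \<le> \<beta> + t\<^sup>2 * (norm x)\<^sup>2 / 2" for t
    using le[of "t *\<^sub>R x"] linear_scale[OF l, of t x] by (simp add: power_mult_distrib)
  have "(l x)\<^sup>2 \<le> 2 * \<beta> * (norm x)\<^sup>2"
  proof (cases "x = 0")
    case True
    then show ?thesis using linear_0[OF l] by simp
  next
    case False
    then have n: "0 < (norm x)\<^sup>2" by simp
    \<comment> \<open>The choice \<open>t = l x / (norm x)\<^sup>2\<close> makes \<open>t * l x - t\<^sup>2 * (norm x)\<^sup>2 / 2\<close> largest.\<close>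
    have "l x / (norm x)\<^sup>2 * l x \<le> \<beta> + (l x / (norm x)\<^sup>2)\<^sup>2 * (norm x)\<^sup>2 / 2"
      by (rule key)
    also have "(l x / (norm x)\<^sup>2)\<^sup>2 * (norm x)\<^sup>2 = (l x)\<^sup>2 / (norm x)\<^sup>2"
      using n by (simp add: field_simps power2_eq_square)
    finally have "(l x)\<^sup>2 / (norm x)\<^sup>2 \<le> \<beta> + (l x)\<^sup>2 / (norm x)\<^sup>2 / 2"
      by (simp add: power2_eq_square)
    then have "(l x)\<^sup>2 / (norm x)\<^sup>2 \<le> 2 * \<beta>" by simp
    then show ?thesis
      using n by (simp add: pos_divide_le_eq)
  qed
  also have "\<dots> = (sqrt (2 * \<beta>) * norm x)\<^sup>2"
    using \<beta> by (simp add: power_mult_distrib)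
  finally show "\<bar>l x\<bar> \<le> sqrt (2 * \<beta>) * norm x"
    using \<beta> abs_le_square_iff[of "l x" "sqrt (2 * \<beta>) * norm x"] by simp
qed

text \<open>
  This bounds the convex conjugate of half the squared norm, a supremum over \<open>x\<close>, from below by half
  the squared dual norm.
\<close>

lemma half_norm_square_le:
  fixes f :: "'a::real_normed_vector \<Rightarrow>\<^sub>L real"
  assumes "\<And>x. blinfun_apply f x \<le> \<beta> + (norm x)\<^sup>2 / 2"
  shows "(norm f)\<^sup>2 / 2 \<le> \<beta>"
proof -
  have l: "linear (blinfun_apply f)"
    using blinfun.bounded_linear_right bounded_linear.linear by blast
  note * = linear_le_half_norm_square[OF l assms]
  have "norm f \<le> sqrt (2 * \<beta>)"
    by (rule norm_blinfun_bound) (use * in auto)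
  then have "(norm f)\<^sup>2 \<le> (sqrt (2 * \<beta>))\<^sup>2"
    by (intro power_mono) auto
  then show ?thesis
    using *(1) by simp
qed

section \<open>The Fitzpatrick function and surjectivity\<close>

text \<open>
  Otherwise adding the pair \<open>(x, f)\<close> to the graph would give a properly larger monotone operator.
\<close>

lemma maximal_monotone_op_memI:
  assumes max: "maximal_monotone_op A"
    and rel: "\<And>y g. g \<in> A y \<Longrightarrow> 0 \<le> blinfun_apply (f - g) (x - y)"
  shows "f \<in> A x"
proof (rule ccontr)
  assume notin: "f \<notin> A x"
  define B where "B = A(x := insert f (A x))"
  have mono: "0 \<le> blinfun_apply (h - g) (z - y)" if "h \<in> A z" "g \<in> A y" for h z g y
    using max that by (auto simp: maximal_monotone_op_def monotone_op_def op_graph_def)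
  have rel': "0 \<le> blinfun_apply (g - f) (y - x)" if "g \<in> A y" for g y
    using rel[OF that] by (simp add: blinfun.bilinear_simps)
  have "monotone_op B"
    unfolding monotone_op_def op_graph_def B_def
    using mono rel rel' by (auto split: if_splits)
  moreover have "op_graph A \<subset> op_graph B"
    using notin by (auto simp: op_graph_def B_def split: if_splits)
  ultimately show False
    using max by (auto simp: maximal_monotone_op_def)
qed

text \<open>
  The core of the proof, for a graph \<open>G\<close> that is maximal monotone in the form of the preceding lemma,
  as this form is the one that survives scaling and translating an operator. The set \<open>D\<close> is the epigraph
  of the Fitzpatrick function of \<open>G\<close>.
\<close>

lemma maximal_monotone_graph_meets_neg_duality:
  fixes G :: "('a::real_normed_vector \<times> ('a \<Rightarrow>\<^sub>L real)) set"
  assumes refl: "reflexive_space TYPE('a)"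
    and mono: "\<And>x f y g. (x, f) \<in> G \<Longrightarrow> (y, g) \<in> G \<Longrightarrow> 0 \<le> blinfun_apply (f - g) (x - y)"
    and max: "\<And>x f. (\<And>y g. (y, g) \<in> G \<Longrightarrow> 0 \<le> blinfun_apply (f - g) (x - y)) \<Longrightarrow> (x, f) \<in> G"
  obtains x f where "(x, f) \<in> G" "- f \<in> duality_mapping x"
proof -
  define D :: "(('a \<times> ('a \<Rightarrow>\<^sub>L real)) \<times> real) set" where
    "D = {((x, f), r). \<forall>(y, g)\<in>G. blinfun_apply g x + blinfun_apply f y - blinfun_apply g y \<le> r}"
  have G_D: "((x, f), blinfun_apply f x) \<in> D" if "(x, f) \<in> G" for x f
    using mono[OF that] by (fastforce simp: D_def blinfun.bilinear_simps)
  \<comment> \<open>If the bound failed at \<open>(x, f)\<close>, then \<open>(x, f)\<close> would be monotonically related to \<open>G\<close>, hence in \<open>G\<close>,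
     and the defining inequality of \<open>D\<close> at \<open>(y, g) = (x, f)\<close> would give the bound after all.\<close>
  have D_ge: "blinfun_apply f x \<le> r" if D: "((x, f), r) \<in> D" for x f r
  proof (rule ccontr)
    assume less: "\<not> blinfun_apply f x \<le> r"
    have bd: "blinfun_apply g x + blinfun_apply f y - blinfun_apply g y \<le> r" if "(y, g) \<in> G" for y g
      using D that by (auto simp: D_def)
    have "(x, f) \<in> G"
    proof (rule max)
      fix y g assume "(y, g) \<in> G"
      from bd[OF this] less show "0 \<le> blinfun_apply (f - g) (x - y)"
        by (simp add: blinfun.bilinear_simps)
    qed
    from bd[OF this] less show False by simp
  qed
  \<comment> \<open>Every pair is vacuously related to an empty graph.\<close>
  have "G \<noteq> {}"
    using max[of 0 0] by auto
  then have "D \<noteq> {}"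
    using G_D by auto
  moreover have "convex D"
  proof (rule convexI)
    fix p q :: "('a \<times> ('a \<Rightarrow>\<^sub>L real)) \<times> real" and u v :: real
    assume pq: "p \<in> D" "q \<in> D" and uv: "0 \<le> u" "0 \<le> v" "u + v = 1"
    obtain x f r where p: "p = ((x, f), r)" by (metis surj_pair)
    obtain x' f' r' where q: "q = ((x', f'), r')" by (metis surj_pair)
    have "blinfun_apply g (u *\<^sub>R x + v *\<^sub>R x') + blinfun_apply (u *\<^sub>R f + v *\<^sub>R f') y - blinfun_apply g y
        \<le> u * r + v * r'" if yg: "(y, g) \<in> G" for y g
    proof -
      have 1: "blinfun_apply g x + blinfun_apply f y - blinfun_apply g y \<le> r"
        and 2: "blinfun_apply g x' + blinfun_apply f' y - blinfun_apply g y \<le> r'"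
        using pq yg by (auto simp: D_def p q)
      have "blinfun_apply g y = u * blinfun_apply g y + v * blinfun_apply g y"
        using uv by (simp flip: distrib_right)
      then show ?thesis
        using mult_left_mono[OF 1 uv(1)] mult_left_mono[OF 2 uv(2)]
        by (simp add: blinfun.bilinear_simps algebra_simps)
    qed
    then show "u *\<^sub>R p + v *\<^sub>R q \<in> D"
      by (auto simp: D_def p q)
  qed
  moreover have "- ((norm z)\<^sup>2 / 2) \<le> r" if "(z, r) \<in> D" for z r
  proof -
    obtain x f where z: "z = (x, f)" by (cases z)
    have "- (norm f * norm x) \<le> blinfun_apply f x"
      using norm_blinfun[of f x] by (simp add: abs_le_iff)
    moreover have "norm f * norm x \<le> (norm z)\<^sup>2 / 2"
      using sum_squares_bound[of "norm f" "norm x"] by (simp add: z norm_Pair)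
    ultimately show ?thesis
      using D_ge[of x f r] that z by simp
  qed
  ultimately obtain l \<alpha> where l: "linear l"
    and lower: "\<And>z r. (z, r) \<in> D \<Longrightarrow> l z + \<alpha> \<le> r"
    and upper: "\<And>z. - ((norm z)\<^sup>2 / 2) \<le> l z + \<alpha>"
    using affine_sandwich[of D "\<lambda>z. (norm z)\<^sup>2 / 2"] convex_on_half_norm_square by blast
  have "linear (\<lambda>z. - l z)"
    using l by (simp add: linear_compose_neg)
  moreover have "- l z \<le> \<alpha> + (norm z)\<^sup>2 / 2" for z
    using upper[of z] by simp
  ultimately have abs: "\<bar>l z\<bar> \<le> sqrt (2 * \<alpha>) * norm z" for z
    using linear_le_half_norm_square(2)[of "\<lambda>z. - l z" \<alpha> z] by simp
  have bl: "bounded_linear l"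
    by (rule bounded_linear_intro[of _ "sqrt (2 * \<alpha>)"])
      (use abs linear_add[OF l] linear_scale[OF l] in \<open>auto simp: mult.commute\<close>)
  have bl1: "bounded_linear (\<lambda>x. l (x, 0))" and bl2: "bounded_linear (\<lambda>f. l (0, f))"
    by (rule bounded_linear_compose[OF bl], simp add: bounded_linear_Pair)+
  define h where "h = Blinfun (\<lambda>x. l (x, 0))"
  define Y where "Y = Blinfun (\<lambda>f. l (0, f))"
  obtain y where y: "canonical_embedding y = Y"
    using refl unfolding reflexive_space_def by (metis surjD)
  have l_eq: "l (x, f) = blinfun_apply h x + blinfun_apply f y" for x f
  proof -
    have "l (x, f) = l (x, 0) + l (0, f)"
      using linear_add[OF l, of "(x, 0)" "(0, f)"] by simp
    also have "l (x, 0) = blinfun_apply h x"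
      using bl1 by (simp add: h_def bounded_linear_Blinfun_apply)
    also have "l (0, f) = blinfun_apply (canonical_embedding y) f"
      using bl2 by (simp add: y Y_def bounded_linear_Blinfun_apply)
    finally show ?thesis
      by (simp add: canonical_embedding.rep_eq)
  qed
  have upper': "- ((norm x)\<^sup>2 / 2) - (norm f)\<^sup>2 / 2 \<le> blinfun_apply h x + blinfun_apply f y + \<alpha>" for x f
    using upper[of "(x, f)"] by (simp add: l_eq norm_Pair add_divide_distrib)
  \<comment> \<open>The bound \<open>upper'\<close> is optimised in \<open>f\<close> for fixed \<open>x\<close>, and then in \<open>x\<close>. The first
     step controls the norm of \<open>y\<close> as a functional on the dual, which is its norm in the space.\<close>
  have "(norm (- h))\<^sup>2 / 2 \<le> \<alpha> - (norm y)\<^sup>2 / 2"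
  proof (rule half_norm_square_le)
    fix x
    have "(norm (- canonical_embedding y))\<^sup>2 / 2 \<le> blinfun_apply h x + \<alpha> + (norm x)\<^sup>2 / 2"
    proof (rule half_norm_square_le)
      show "blinfun_apply (- canonical_embedding y) f
          \<le> blinfun_apply h x + \<alpha> + (norm x)\<^sup>2 / 2 + (norm f)\<^sup>2 / 2" for f
        using upper'[of x f] by (simp add: blinfun.bilinear_simps canonical_embedding.rep_eq)
    qed
    then show "blinfun_apply (- h) x \<le> \<alpha> - (norm y)\<^sup>2 / 2 + (norm x)\<^sup>2 / 2"
      by (simp add: blinfun.bilinear_simps norm_canonical_embedding)
  qed
  then have \<alpha>: "(norm h)\<^sup>2 / 2 + (norm y)\<^sup>2 / 2 \<le> \<alpha>"
    by simp
  have hy: "- (norm h * norm y) \<le> blinfun_apply h y"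
    using norm_blinfun[of h y] by (simp add: abs_le_iff)
  have gap: "(norm h - norm y)\<^sup>2 / 2 \<le> (norm h)\<^sup>2 / 2 + (norm y)\<^sup>2 / 2 + blinfun_apply h y"
    using hy by (simp add: power2_diff field_simps)
  have diff: "(norm h)\<^sup>2 / 2 + (norm y)\<^sup>2 / 2 + blinfun_apply h y \<le> blinfun_apply (h - g) (y - b)"
    if "(b, g) \<in> G" for b g
    using lower[OF G_D[OF that]] \<alpha> by (simp add: l_eq blinfun.bilinear_simps)
  have "(y, h) \<in> G"
    using order_trans[OF _ diff] order_trans[OF _ gap] by (intro max) simp
  moreover have eq: "norm h = norm y" "blinfun_apply h y = - (norm y)\<^sup>2"
  proof -
    have S: "(norm h)\<^sup>2 / 2 + (norm y)\<^sup>2 / 2 + blinfun_apply h y \<le> 0"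
      using diff[OF \<open>(y, h) \<in> G\<close>] by simp
    then have "(norm h - norm y)\<^sup>2 \<le> 0"
      using gap by linarith
    then show "norm h = norm y"
      by simp
    then show "blinfun_apply h y = - (norm y)\<^sup>2"
      using S hy by (simp add: power2_eq_square)
  qed
  then have "- h \<in> duality_mapping y"
    by (simp add: duality_mapping_def blinfun.bilinear_simps)
  ultimately show thesis
    by (rule that)
qed

theorem theorem6:
  fixes A :: "'a::banach \<Rightarrow> ('a \<Rightarrow>\<^sub>L real) set"
  assumes "reflexive_space TYPE('a)"
    and "maximal_monotone_op A"
  shows "\<forall>c>0. op_range (op_add duality_mapping (op_scale c A)) = UNIV"
proof (intro allI impI)
  fix c :: real assume c: "0 < c"
  have mono: "0 \<le> blinfun_apply (f - g) (x - y)" if "f \<in> A x" "g \<in> A y" for f x g y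
    using assms(2) that by (auto simp: maximal_monotone_op_def monotone_op_def op_graph_def)
  have "p \<in> op_range (op_add duality_mapping (op_scale c A))" for p
  proof -
    define G where "G = {(x, c *\<^sub>R a - p) | x a. a \<in> A x}"
    obtain x f where "(x, f) \<in> G" and f: "- f \<in> duality_mapping x"
    proof (rule maximal_monotone_graph_meets_neg_duality[OF assms(1), of G])
      fix x f y g assume "(x, f) \<in> G" "(y, g) \<in> G"
      then obtain a b where ab: "a \<in> A x" "b \<in> A y" and fg: "f = c *\<^sub>R a - p" "g = c *\<^sub>R b - p"
        by (auto simp: G_def)
      have "f - g = c *\<^sub>R (a - b)"
        by (simp add: fg scaleR_diff_right)
      then show "0 \<le> blinfun_apply (f - g) (x - y)"
        using mono[OF ab] c by (simp add: blinfun.scaleR_left)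
    next
      fix x f assume rel: "\<And>y g. (y, g) \<in> G \<Longrightarrow> 0 \<le> blinfun_apply (f - g) (x - y)"
      have "(1 / c) *\<^sub>R (f + p) \<in> A x"
      proof (rule maximal_monotone_op_memI[OF assms(2)])
        fix y a assume "a \<in> A y"
        then have "0 \<le> blinfun_apply (f - (c *\<^sub>R a - p)) (x - y)"
          by (intro rel) (auto simp: G_def)
        also have "f - (c *\<^sub>R a - p) = c *\<^sub>R ((1 / c) *\<^sub>R (f + p) - a)"
          using c by (simp add: algebra_simps)
        finally show "0 \<le> blinfun_apply ((1 / c) *\<^sub>R (f + p) - a) (x - y)"
          using c by (simp add: blinfun.scaleR_left zero_le_mult_iff)
      qed
      then show "(x, f) \<in> G"
        using c by (force simp: G_def)
    qed (rule that)
    then obtain a where "a \<in> A x" "f = c *\<^sub>R a - p"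
      by (auto simp: G_def)
    then have "p = - f + c *\<^sub>R a" "c *\<^sub>R a \<in> op_scale c A x"
      by (auto simp: op_scale_def)
    then show ?thesis
      using f unfolding op_range_def op_add_def by blast
  qed
  then show "op_range (op_add duality_mapping (op_scale c A)) = UNIV"
    by auto
qed

end
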